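(* For integers $m,n\ge 2$, the graph $\mathrm{OFG}(M_{m,n})$ has exactly four vertices of degree $2$. They are the corner gradients \[ h_\varepsilon(i,j)=\varepsilon_1(i-1)+\varepsilon_2(j-1),\qquad \varepsilon=(\varepsilon_1,\varepsilon_2)\in\{+1,-1\}^2, \] whose unique strict local minimum and unique strict local maximum lie at opposite corners of the grid.
   Context: $G_{m,n}$ is the grid graph with vertex set $\{(i,j): 1\le i\le m,\ 1\le j\le n\}$, each vertex joined to its horizontal and vertical neighbours. A proper $3$-colouring is a map $c:V(G_{m,n})\to\mathbb{Z}/3\mathbb{Z}$ with $c(u)\ne c(v)$ for every edge $uv$. $\mathrm{OFG}(M_{m,n})$ is the origami flip graph of the $m\times n$ Miura-ori (vertices: flat-foldable mountain--valley assignments; edges: single face flips). Throughout it is identified, by a known bijection, with the following simple graph: its vertices are the orbits of proper $3$-colourings of $G_{m,n}$ under the global colour rotation $c\mapsto c+1$ (action of $\mathbb{Z}/3\mathbb{Z}$), and two distinct orbits are adjacent if and only if they contain representatives that differ at exactly one vertex of $G_{m,n}$. A height function is a function $h:V(G_{m,n})\to\mathbb{Z}$ with $|h(u)-h(v)|=1$ for every edge $uv$. Reduction modulo $3$ gives a bijection between height functions normalised by $h(1,1)=0$ and vertices of $\mathrm{OFG}(M_{m,n})$; each vertex of $\mathrm{OFG}(M_{m,n})$ is identified with its normalised height function. A grid vertex $v$ is a strict local maximum of $h$ if every neighbour $u$ satisfies $h(u)=h(v)-1$, and a strict local minimum if every neighbour $u$ satisfies $h(u)=h(v)+1$. The corners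 are $(1,1),(1,n),(m,1),(m,n)$; opposite corners are $(1,1),(m,n)$ and $(1,n),(m,1)$. *)

theory Defs
  imports Complex_Main "HOL-Library.FuncSet" "HOL-Library.Numeral_Type"
begin

definition grid :: "nat \<Rightarrow> nat \<Rightarrow> (nat \<times> nat) set" where
  "grid m n = {1..m} \<times> {1..n}"

definition grid_adj :: "nat \<Rightarrow> nat \<Rightarrow> nat \<times> nat \<Rightarrow> nat \<times> nat \<Rightarrow> bool" where
  "grid_adj m n u v \<longleftrightarrow> u \<in> grid m n \<and> v \<in> grid m n \<and>
     ((fst u = fst v \<and> (snd u = snd v + 1 \<or> snd v = snd u + 1)) \<or>
      (snd u = snd v \<and> (fst u = fst v + 1 \<or> fst v = fst u + 1)))"

(* The numeral type 3 of HOL-Library is the ring Z/3Z.  Maps defined on the grid are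
   extensional (undefined off the grid), so that equality of maps is equality on the grid. *)
definition proper_colourings :: "nat \<Rightarrow> nat \<Rightarrow> (nat \<times> nat \<Rightarrow> 3) set" where
  "proper_colourings m n =
     {c \<in> extensional (grid m n). \<forall>u v. grid_adj m n u v \<longrightarrow> c u \<noteq> c v}"

definition rotate_colouring :: "nat \<Rightarrow> nat \<Rightarrow> 3 \<Rightarrow> (nat \<times> nat \<Rightarrow> 3) \<Rightarrow> (nat \<times> nat \<Rightarrow> 3)" where
  "rotate_colouring m n k c = (\<lambda>v \<in> grid m n. c v + k)"

definition colouring_orbit :: "nat \<Rightarrow> nat \<Rightarrow> (nat \<times> nat \<Rightarrow> 3) \<Rightarrow> (nat \<times> nat \<Rightarrow> 3) set" where
  "colouring_orbit m n c = range (\<lambda>k. rotate_colouring m n k c)"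

definition ofg_verts :: "nat \<Rightarrow> nat \<Rightarrow> (nat \<times> nat \<Rightarrow> 3) set set" where
  "ofg_verts m n = colouring_orbit m n ` proper_colourings m n"

definition ofg_adj :: "nat \<Rightarrow> nat \<Rightarrow> (nat \<times> nat \<Rightarrow> 3) set \<Rightarrow> (nat \<times> nat \<Rightarrow> 3) set \<Rightarrow> bool" where
  "ofg_adj m n A B \<longleftrightarrow> A \<in> ofg_verts m n \<and> B \<in> ofg_verts m n \<and> A \<noteq> B \<and>
     (\<exists>c \<in> A. \<exists>d \<in> B. \<exists>!v. v \<in> grid m n \<and> c v \<noteq> d v)"

definition ofg_degree :: "nat \<Rightarrow> nat \<Rightarrow> (nat \<times> nat \<Rightarrow> 3) set \<Rightarrow> nat" where
  "ofg_degree m n A = card {B. ofg_adj m n A B}"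

definition height_functions :: "nat \<Rightarrow> nat \<Rightarrow> (nat \<times> nat \<Rightarrow> int) set" where
  "height_functions m n =
     {h \<in> extensional (grid m n). \<forall>u v. grid_adj m n u v \<longrightarrow> \<bar>h u - h v\<bar> = 1}"

definition normalised_heights :: "nat \<Rightarrow> nat \<Rightarrow> (nat \<times> nat \<Rightarrow> int) set" where
  "normalised_heights m n = {h \<in> height_functions m n. h (1, 1) = 0}"

(* The vertex of the flip graph identified with a normalised height function: the orbit of
   its reduction modulo 3. *)
definition vertex_of_height :: "nat \<Rightarrow> nat \<Rightarrow> (nat \<times> nat \<Rightarrow> int) \<Rightarrow> (nat \<times> nat \<Rightarrow> 3) set" where
  "vertex_of_height m n h = colouring_orbit m n (\<lambda>v \<in> grid m n. of_int (h v))"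

definition strict_local_max :: "nat \<Rightarrow> nat \<Rightarrow> (nat \<times> nat \<Rightarrow> int) \<Rightarrow> nat \<times> nat \<Rightarrow> bool" where
  "strict_local_max m n h v \<longleftrightarrow> v \<in> grid m n \<and> (\<forall>u. grid_adj m n u v \<longrightarrow> h u = h v - 1)"

definition strict_local_min :: "nat \<Rightarrow> nat \<Rightarrow> (nat \<times> nat \<Rightarrow> int) \<Rightarrow> nat \<times> nat \<Rightarrow> bool" where
  "strict_local_min m n h v \<longleftrightarrow> v \<in> grid m n \<and> (\<forall>u. grid_adj m n u v \<longrightarrow> h u = h v + 1)"

definition opposite_corners :: "nat \<Rightarrow> nat \<Rightarrow> nat \<times> nat \<Rightarrow> nat \<times> nat \<Rightarrow> bool" where
  "opposite_corners m n p q \<longleftrightarrow> {p, q} = {(1, 1), (m, n)} \<or> {p, q} = {(1, n), (m, 1)}"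

definition corner_gradient :: "nat \<Rightarrow> nat \<Rightarrow> int \<Rightarrow> int \<Rightarrow> (nat \<times> nat \<Rightarrow> int)" where
  "corner_gradient m n e1 e2 = (\<lambda>(i, j) \<in> grid m n. e1 * (int i - 1) + e2 * (int j - 1))"

end

theory Submission
  imports Defs
begin

text \<open>A colouring can be changed at a vertex in at most one way, and this is possible exactly when
  all its neighbours share a colour. On a grid with at least four vertices, different changes lead
  to different orbits, so the degree of an orbit counts these vertices. In terms of a height
  function lifting the colouring they are the strict local extrema. There are always at least one
  maximum and one minimum; if there is only one maximum \<open>p\<close> and one minimum \<open>q\<close>, then climbing to
  \<open>p\<close> and descending to \<open>q\<close> along monotone paths shows that
  \<open>h v = h p - d(v, p) = h q + d(v, q)\<close>. Hence every vertex lies on a geodesic from \<open>q\<close> to \<open>p\<close>,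
  which forces these two to be opposite corners and \<open>h\<close> to be linear.\<close>

section \<open>Arithmetic modulo 3 and integer lifts of colour differences\<close>

lemma exhaust_mod3: "(x::3) = 0 \<or> x = 1 \<or> x = 2"
proof (cases x)
  case (of_int z)
  then have "z = 0 \<or> z = 1 \<or> z = 2" by auto
  with of_int show ?thesis by auto
qed

lemma of_int_mod3_eq_0_iff: "(of_int a :: 3) = 0 \<longleftrightarrow> a mod 3 = 0"
proof -
  have three: "(3::3) = 0" by simp
  have "(of_int a :: 3) = of_int (3 * (a div 3) + a mod 3)" by simp
  also have "\<dots> = of_int (a mod 3)" unfolding of_int_add of_int_mult of_int_numeral three by simp
  finally have *: "(of_int a :: 3) = of_int (a mod 3)" .
  have "a mod 3 = 0 \<or> a mod 3 = 1 \<or> a mod 3 = 2" by presburger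
  with * show ?thesis by auto
qed

lemma of_int_mod3_eq_iff: "(of_int a :: 3) = of_int b \<longleftrightarrow> (a - b) mod 3 = 0"
  using of_int_mod3_eq_0_iff[of "a - b"] by simp

text \<open>The three elements of Z/3Z sum to 0, so the one that differs from \<open>x\<close> and
  \<open>y\<close> is minus their sum.\<close>

lemma third_colour:
  fixes x y z :: 3
  assumes "x \<noteq> y"
  shows "z \<noteq> y \<and> z \<noteq> x \<longleftrightarrow> z = - x - y"
  using exhaust_mod3[of x] exhaust_mod3[of y] exhaust_mod3[of z] assms by auto

text \<open>On nonzero differences this is the representative in {1, -1}. The value at 0 is a
  default that lets \<open>abs_lift_step\<close> hold without a side condition.\<close>

definition lift_step :: "3 \<Rightarrow> int" where
  "lift_step x = (if x = 1 then 1 else - 1)"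

lemma abs_lift_step [simp]: "\<bar>lift_step x\<bar> = 1"
  by (simp add: lift_step_def)

lemma of_int_lift_step: "x \<noteq> 0 \<Longrightarrow> of_int (lift_step x) = x"
  using exhaust_mod3[of x] by (auto simp: lift_step_def)

text \<open>The sum of the four steps around a unit square is even, at most 4 in absolute value and
  divisible by 3, hence zero: the lift does not depend on the path.\<close>

lemma lift_step_square:
  assumes "a \<noteq> b" "b \<noteq> d" "a \<noteq> c" "c \<noteq> d"
  shows "lift_step (b - a) + lift_step (d - b) = lift_step (c - a) + lift_step (d - c)"
  using exhaust_mod3[of a] exhaust_mod3[of b] exhaust_mod3[of c] exhaust_mod3[of d] assms
  by (auto simp: lift_step_def)


section \<open>Single-vertex changes of a proper colouring\<close>

lemma grid_adj_in_grid: "grid_adj m n u v \<Longrightarrow> u \<in> grid m n \<and> v \<in> grid m n \<and> u \<noteq> v"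
  by (auto simp: grid_adj_def)

lemma grid_adj_sym: "grid_adj m n u v \<longleftrightarrow> grid_adj m n v u"
  by (auto simp: grid_adj_def)

lemma grid_neighbour_exists:
  assumes "m \<ge> 2" "n \<ge> 2" "v \<in> grid m n"
  shows "\<exists>u. grid_adj m n v u"
proof (cases "fst v < m")
  case True
  with assms have "grid_adj m n v (fst v + 1, snd v)" by (auto simp: grid_adj_def grid_def)
  then show ?thesis by blast
next
  case False
  with assms have "grid_adj m n v (fst v - 1, snd v)" by (auto simp: grid_adj_def grid_def)
  then show ?thesis by blast
qed

definition flippable :: "nat \<Rightarrow> nat \<Rightarrow> (nat \<times> nat \<Rightarrow> 3) \<Rightarrow> nat \<times> nat \<Rightarrow> bool" where
  "flippable m n c v \<longleftrightarrow> v \<in> grid m n \<and>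
     (\<forall>u w. grid_adj m n v u \<longrightarrow> grid_adj m n v w \<longrightarrow> c u = c w)"

text \<open>The new colour is the third one in the sense of \<open>third_colour\<close>. At a
  flippable vertex all neighbours share a colour, so the choice of neighbour does not affect the
  result.\<close>

definition flip :: "nat \<Rightarrow> nat \<Rightarrow> (nat \<times> nat \<Rightarrow> 3) \<Rightarrow> nat \<times> nat \<Rightarrow> (nat \<times> nat \<Rightarrow> 3)" where
  "flip m n c v = c(v := - c v - c (SOME u. grid_adj m n v u))"

lemma proper_colouringsD:
  "c \<in> proper_colourings m n \<Longrightarrow> grid_adj m n u v \<Longrightarrow> c u \<noteq> c v"
  unfolding proper_colourings_def by blast

lemma proper_extensional: "c \<in> proper_colourings m n \<Longrightarrow> c \<in> extensional (grid m n)"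
  by (simp add: proper_colourings_def)

lemma flip_eq:
  assumes "flippable m n c v" "grid_adj m n v u"
  shows "flip m n c v = c(v := - c v - c u)"
proof -
  have "grid_adj m n v (SOME u. grid_adj m n v u)" using assms(2) by (rule someI)
  with assms show ?thesis unfolding flip_def flippable_def by metis
qed

text \<open>The third colour differs both from the old colour of \<open>v\<close> and from the
  common colour of its neighbours; edges away from \<open>v\<close> are untouched.\<close>

lemma flip_proper:
  assumes "m \<ge> 2" "n \<ge> 2" "c \<in> proper_colourings m n" "flippable m n c v"
  shows "flip m n c v \<in> proper_colourings m n" "flip m n c v v \<noteq> c v"
proof -
  have v: "v \<in> grid m n" using assms by (simp add: flippable_def)
  obtain u where u: "grid_adj m n v u" using grid_neighbour_exists assms(1,2) v by blast
  have cu: "c v \<noteq> c u" using assms(3) u by (rule proper_colouringsD)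
  have fl: "flip m n c v = c(v := - c v - c u)" using assms(4) u by (rule flip_eq)
  have new: "- c v - c u \<noteq> c u" "- c v - c u \<noteq> c v"
    using third_colour[OF cu] by blast+
  show "flip m n c v v \<noteq> c v" using fl new by simp
  have nb: "c w = c u" if "grid_adj m n v w" for w
    using assms(4) u that unfolding flippable_def by blast
  have "flip m n c v w \<noteq> flip m n c v w'" if a: "grid_adj m n w w'" for w w'
  proof -
    have "w \<noteq> w'" using grid_adj_in_grid[OF a] by blast
    moreover have "c w = c u" if "w' = v" using nb a that grid_adj_sym by blast
    moreover have "c w' = c u" if "w = v" using nb a that by blast
    ultimately show ?thesis using new proper_colouringsD[OF assms(3) a] unfolding fl
      by (metis fun_upd_apply)
  qed
  moreover have "flip m n c v \<in> extensional (grid m n)"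
    using assms(3) v unfolding fl by (auto simp: proper_colourings_def extensional_def)
  ultimately show "flip m n c v \<in> proper_colourings m n"
    by (simp add: proper_colourings_def)
qed

text \<open>A neighbour of \<open>v\<close> has the same colour in \<open>c\<close> and
  \<open>d\<close>, and this colour must avoid both \<open>c v\<close> and \<open>d v\<close>. By
  \<open>third_colour\<close> that leaves one value, common to all neighbours.\<close>

lemma eq_flip_of_differ_once:
  assumes "m \<ge> 2" "n \<ge> 2" "c \<in> proper_colourings m n" "d \<in> proper_colourings m n"
    and v: "v \<in> grid m n" "c v \<noteq> d v" and rest: "\<And>w. w \<in> grid m n \<Longrightarrow> w \<noteq> v \<Longrightarrow> c w = d w"
  shows "flippable m n c v" "d = flip m n c v"
proof -
  have nb: "c w = - c v - d v" if "grid_adj m n v w" for w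
  proof -
    have w: "c w = d w" using rest grid_adj_in_grid[OF that] by metis
    have "c w \<noteq> c v" "c w \<noteq> d v"
      using proper_colouringsD[OF assms(3) that] proper_colouringsD[OF assms(4) that] w by auto
    then show ?thesis using third_colour[OF v(2)] by blast
  qed
  show fl: "flippable m n c v" using v nb by (auto simp: flippable_def)
  obtain u where u: "grid_adj m n v u" using grid_neighbour_exists assms(1,2) v by blast
  \<comment> \<open>With neighbour colour \<open>- c v - d v\<close>, the new colour
    \<open>- c v - c u\<close> simplifies to \<open>d v\<close>.\<close>
  have fl_eq: "flip m n c v = c(v := d v)" using flip_eq[OF fl u] nb[OF u] by simp
  have "d w = (c(v := d v)) w" for w
    using v(1) rest[of w] extensional_arb[OF proper_extensional[OF assms(3)]]
      extensional_arb[OF proper_extensional[OF assms(4)]] by (cases "w \<in> grid m n") auto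
  then show "d = flip m n c v" unfolding fl_eq by (rule ext)
qed

section \<open>Rotation orbits and the degree in the flip graph\<close>

lemma rotate_proper:
  "c \<in> proper_colourings m n \<Longrightarrow> rotate_colouring m n k c \<in> proper_colourings m n"
  using grid_adj_in_grid by (fastforce simp: proper_colourings_def rotate_colouring_def)

lemma rotate_rotate:
  "rotate_colouring m n k (rotate_colouring m n l c) = rotate_colouring m n (l + k) c"
  by (auto simp: rotate_colouring_def add.assoc)

lemma rotate_zero: "c \<in> extensional (grid m n) \<Longrightarrow> rotate_colouring m n 0 c = c"
  by (auto simp: rotate_colouring_def extensional_def)

lemma self_in_orbit: "c \<in> extensional (grid m n) \<Longrightarrow> c \<in> colouring_orbit m n c"
  unfolding colouring_orbit_def using rotate_zero by (metis rangeI)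

lemma orbit_eq_of_mem:
  assumes "d \<in> colouring_orbit m n c"
  shows "colouring_orbit m n d = colouring_orbit m n c"
proof -
  obtain k where k: "d = rotate_colouring m n k c" using assms by (auto simp: colouring_orbit_def)
  have "rotate_colouring m n l c = rotate_colouring m n (l - k) d" for l
    unfolding k rotate_rotate by simp
  moreover have "rotate_colouring m n l d = rotate_colouring m n (k + l) c" for l
    unfolding k rotate_rotate by simp
  ultimately show ?thesis unfolding colouring_orbit_def by fastforce
qed

text \<open>Rotation acts freely at every single vertex: if the rotation taking \<open>d\<close> to
  \<open>c\<close> preserves the colour at \<open>x\<close>, its amount is 0.\<close>

lemma orbit_eq_agree:
  assumes "c \<in> extensional (grid m n)" "d \<in> extensional (grid m n)"
    and "colouring_orbit m n c = colouring_orbit m n d"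
    and "x \<in> grid m n" "c x = d x"
  shows "c = d"
proof -
  have "c \<in> colouring_orbit m n d" using self_in_orbit assms(1,3) by blast
  then obtain k where k: "c = rotate_colouring m n k d" by (auto simp: colouring_orbit_def)
  then have "k = 0" using assms(4,5) by (simp add: rotate_colouring_def)
  then show ?thesis using k assms(2) by (simp add: rotate_zero)
qed

text \<open>Supplies a vertex untouched by two given flips, at which \<open>orbit_eq_agree\<close>
  can compare the results.\<close>

lemma grid_avoid_two:
  assumes "m \<ge> 2" "n \<ge> 2"
  shows "\<exists>x \<in> grid m n. x \<noteq> v \<and> x \<noteq> w"
proof -
  have "(1,1) \<in> grid m n" "(1,2) \<in> grid m n" "(2,1) \<in> grid m n"
    using assms by (auto simp: grid_def)
  then show ?thesis by (metis Pair_inject numeral_eq_one_iff semiring_norm(85))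
qed

text \<open>The map \<open>?f\<close> is a bijection from flippable vertices to neighbouring orbits.
  Freeness of the rotation gives injectivity and excludes loops; surjectivity comes from rotating
  the two witnesses of an edge so that the first becomes \<open>c\<close>.\<close>

lemma ofg_degree_eq_card_flippable:
  assumes mn: "m \<ge> 2" "n \<ge> 2" and c: "c \<in> proper_colourings m n"
  shows "ofg_degree m n (colouring_orbit m n c) = card {v. flippable m n c v}"
proof -
  let ?A = "colouring_orbit m n c" and ?f = "\<lambda>v. colouring_orbit m n (flip m n c v)"
  have ext: "flip m n c v \<in> extensional (grid m n)" if "flippable m n c v" for v
    using flip_proper(1)[OF mn c that] by (rule proper_extensional)
  have flip_other: "flip m n c v x = c x" if "x \<noteq> v" for v x
    using that by (simp add: flip_def)
  have "inj_on ?f {v. flippable m n c v}"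
  proof (rule inj_onI, unfold mem_Collect_eq)
    fix v w
    assume fl: "flippable m n c v" "flippable m n c w" and eq: "?f v = ?f w"
    obtain x where x: "x \<in> grid m n" "x \<noteq> v" "x \<noteq> w" using grid_avoid_two[OF mn] by metis
    have "flip m n c v = flip m n c w"
      using orbit_eq_agree[OF ext[OF fl(1)] ext[OF fl(2)] eq x(1)] flip_other x by simp
    \<comment> \<open>If \<open>v\<close> and \<open>w\<close> were different, the flip at
      \<open>w\<close> would keep \<open>c v\<close>, whereas the flip at \<open>v\<close> changes
      it.\<close>
    then show "v = w" using flip_proper(2)[OF mn c fl(1)] flip_other by metis
  qed
  moreover have "?f ` {v. flippable m n c v} = {B. ofg_adj m n ?A B}"
  proof (intro equalityI subsetI)
    fix B assume "B \<in> ?f ` {v. flippable m n c v}"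
    then obtain v where fl: "flippable m n c v" and B: "B = ?f v" by blast
    have v: "v \<in> grid m n" using fl by (simp add: flippable_def)
    have "?A \<noteq> ?f v"
    proof
      assume eq: "?A = ?f v"
      obtain x where x: "x \<in> grid m n" "x \<noteq> v" using grid_avoid_two[OF mn] by metis
      have "c = flip m n c v"
        using orbit_eq_agree[OF proper_extensional[OF c] ext[OF fl] eq x(1)] flip_other x by simp
      then show False using flip_proper(2)[OF mn c fl] by simp
    qed
    moreover have "\<exists>!w. w \<in> grid m n \<and> c w \<noteq> flip m n c v w"
      using v flip_proper(2)[OF mn c fl] flip_other by metis
    ultimately have "ofg_adj m n ?A B"
      unfolding B ofg_adj_def ofg_verts_def
      using c flip_proper(1)[OF mn c fl] self_in_orbit[OF proper_extensional[OF c]]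
        self_in_orbit[OF ext[OF fl]] by blast
    then show "B \<in> {B. ofg_adj m n ?A B}" by simp
  next
    fix B assume "B \<in> {B. ofg_adj m n ?A B}"
    then obtain c' d v where B: "B \<in> ofg_verts m n" and c': "c' \<in> ?A" and d: "d \<in> B"
      and v: "v \<in> grid m n" "c' v \<noteq> d v"
      and rest: "\<And>w. w \<in> grid m n \<Longrightarrow> w \<noteq> v \<Longrightarrow> c' w = d w"
      unfolding ofg_adj_def by blast
    obtain k where k: "c' = rotate_colouring m n k c" using c' by (auto simp: colouring_orbit_def)
    obtain b where b: "b \<in> proper_colourings m n" "B = colouring_orbit m n b"
      using B by (auto simp: ofg_verts_def)
    \<comment> \<open>The edge is witnessed by \<open>c'\<close>, which is \<open>c\<close> rotated
      by \<open>k\<close>. Undoing this rotation on both witnesses restores \<open>c\<close> and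
      leaves the set of vertices where they differ unchanged.\<close>
    define d' where "d' = rotate_colouring m n (- k) d"
    obtain l where "d = rotate_colouring m n l b" using d b by (auto simp: colouring_orbit_def)
    then have dd: "d' = rotate_colouring m n (l - k) b" by (simp add: d'_def rotate_rotate)
    have pd: "d' \<in> proper_colourings m n" unfolding dd by (rule rotate_proper[OF b(1)])
    have "d' \<in> colouring_orbit m n b" unfolding dd colouring_orbit_def by blast
    then have B': "B = colouring_orbit m n d'" using orbit_eq_of_mem b(2) by metis
    have "c v \<noteq> d' v" using v k by (auto simp: d'_def rotate_colouring_def algebra_simps)
    moreover have "c w = d' w" if "w \<in> grid m n" "w \<noteq> v" for w
      using rest[OF that] that k by (auto simp: d'_def rotate_colouring_def algebra_simps)
    ultimately show "B \<in> ?f ` {v. flippable m n c v}"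
      using eq_flip_of_differ_once[OF mn c pd v(1)] B' by blast
  qed
  ultimately show ?thesis unfolding ofg_degree_def by (metis card_image)
qed


section \<open>Lifting a colouring to a height function\<close>

text \<open>Extensionality is dropped from the condition in \<open>height_functions\<close>, so that
  it also applies to \<open>colouring_lift\<close> and to pointwise negations.\<close>

definition unit_steps :: "nat \<Rightarrow> nat \<Rightarrow> (nat \<times> nat \<Rightarrow> int) \<Rightarrow> bool" where
  "unit_steps m n h \<longleftrightarrow> (\<forall>u v. grid_adj m n u v \<longrightarrow> \<bar>h u - h v\<bar> = 1)"

text \<open>Steps are summed along one fixed path from (1, 1): first through the vertices with
  second coordinate 1, then with first coordinate \<open>i\<close>. The value at (1, 1) is
  0.\<close>

definition colouring_lift :: "(nat \<times> nat \<Rightarrow> 3) \<Rightarrow> nat \<times> nat \<Rightarrow> int" where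
  "colouring_lift c = (\<lambda>(i, j). (\<Sum>a=1..<i. lift_step (c (Suc a, 1) - c (a, 1))) +
     (\<Sum>b=1..<j. lift_step (c (i, Suc b) - c (i, b))))"

lemma colouring_lift_right:
  "1 \<le> j \<Longrightarrow> colouring_lift c (i, Suc j) = colouring_lift c (i, j) + lift_step (c (i, Suc j) - c (i, j))"
  by (simp add: colouring_lift_def)

text \<open>The chosen path does not end with this step unless \<open>j = 1\<close>. Induction on
  \<open>j\<close> carries the step across one unit square at a time by
  \<open>lift_step_square\<close>.\<close>

lemma colouring_lift_down:
  assumes c: "c \<in> proper_colourings m n" and i: "1 \<le> i" "Suc i \<le> m" and j: "1 \<le> j" "j \<le> n"
  shows "colouring_lift c (Suc i, j) = colouring_lift c (i, j) + lift_step (c (Suc i, j) - c (i, j))"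
  using j
proof (induction j rule: dec_induct)
  case base
  show ?case using i by (simp add: colouring_lift_def)
next
  case (step j)
  have "grid_adj m n (i, j) (i, Suc j)" "grid_adj m n (i, Suc j) (Suc i, Suc j)"
    "grid_adj m n (i, j) (Suc i, j)" "grid_adj m n (Suc i, j) (Suc i, Suc j)"
    using i step by (auto simp: grid_adj_def grid_def)
  note sq = lift_step_square[OF this[THEN proper_colouringsD[OF c]]]
  show ?case using step sq by (simp add: colouring_lift_right)
qed

lemma unit_steps_colouring_lift:
  assumes c: "c \<in> proper_colourings m n"
  shows "unit_steps m n (colouring_lift c)"
  unfolding unit_steps_def
proof (intro allI impI)
  fix u v assume a: "grid_adj m n u v"
  obtain i j i' j' where uv: "u = (i, j)" "v = (i', j')" by fastforce
  have g: "1 \<le> i" "i \<le> m" "1 \<le> j" "j \<le> n" "1 \<le> i'" "i' \<le> m" "1 \<le> j'" "j' \<le> n"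
    using a by (auto simp: uv grid_adj_def grid_def)
  consider "i = i'" "j' = Suc j" | "i = i'" "j = Suc j'" | "j = j'" "i' = Suc i" | "j = j'" "i = Suc i'"
    using a by (auto simp: uv grid_adj_def)
  then show "\<bar>colouring_lift c u - colouring_lift c v\<bar> = 1"
  proof cases
    case 1 then show ?thesis using g by (simp add: uv colouring_lift_right)
  next
    case 2 then show ?thesis using g by (simp add: uv colouring_lift_right)
  next
    case 3 then show ?thesis using colouring_lift_down[OF c, of i j] g by (simp add: uv)
  next
    case 4 then show ?thesis using colouring_lift_down[OF c, of i' j] g by (simp add: uv)
  qed
qed

text \<open>Each lifted step reduces to the colour difference it came from, so the sum telescopes
  along the path, up to the colour at its start.\<close>

lemma of_int_colouring_lift:
  assumes c: "c \<in> proper_colourings m n" and v: "v \<in> grid m n"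
  shows "c v = of_int (colouring_lift c v) + c (1, 1)"
proof -
  obtain i j where ij: "v = (i, j)" "1 \<le> i" "i \<le> m" "1 \<le> j" "j \<le> n"
    using v by (cases v) (auto simp: grid_def)
  have "c (i, 1) = of_int (colouring_lift c (i, 1)) + c (1, 1)"
    using ij(2,3)
  proof (induction i rule: dec_induct)
    case base show ?case by (simp add: colouring_lift_def)
  next
    case (step a)
    have "grid_adj m n (Suc a, 1) (a, 1)" using step ij by (auto simp: grid_adj_def grid_def)
    then have "of_int (lift_step (c (Suc a, 1) - c (a, 1))) = c (Suc a, 1) - c (a, 1)"
      using proper_colouringsD[OF c] of_int_lift_step by simp
    then show ?case using step colouring_lift_down[OF c, of a 1] ij by simp
  qed
  with ij(4,5) have "c (i, j) = of_int (colouring_lift c (i, j)) + c (1, 1)"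
  proof (induction j rule: dec_induct)
    case base then show ?case by simp
  next
    case (step b)
    have "grid_adj m n (i, Suc b) (i, b)" using step ij by (auto simp: grid_adj_def grid_def)
    then have "of_int (lift_step (c (i, Suc b) - c (i, b))) = c (i, Suc b) - c (i, b)"
      using proper_colouringsD[OF c] of_int_lift_step by simp
    then show ?case using step by (simp add: colouring_lift_right)
  qed
  then show ?thesis by (simp add: ij)
qed

section \<open>Flippable vertices as local extrema\<close>

lemma strict_local_max_iff:
  "strict_local_max m n h v \<longleftrightarrow> v \<in> grid m n \<and> (\<forall>u. grid_adj m n v u \<longrightarrow> h u = h v - 1)"
  unfolding strict_local_max_def using grid_adj_sym by blast

lemma strict_local_min_iff:
  "strict_local_min m n h v \<longleftrightarrow> v \<in> grid m n \<and> (\<forall>u. grid_adj m n v u \<longrightarrow> h u = h v + 1)"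
  unfolding strict_local_min_def using grid_adj_sym by blast

text \<open>Two neighbours of \<open>v\<close> differ in height by -2, 0 or 2, and of these only 0
  is divisible by 3. Hence equal neighbour colours mean equal neighbour heights.\<close>

lemma flippable_iff_local_extremum:
  assumes h: "unit_steps m n h" and c: "\<And>w. w \<in> grid m n \<Longrightarrow> c w = of_int (h w) + k"
  shows "flippable m n c v \<longleftrightarrow> strict_local_max m n h v \<or> strict_local_min m n h v"
proof -
  have near: "h u = h v - 1 \<or> h u = h v + 1" if "grid_adj m n v u" for u
    using h that unfolding unit_steps_def by smt
  have "c u = c w \<longleftrightarrow> h u = h w" if "grid_adj m n v u" "grid_adj m n v w" for u w
  proof -
    have "c u = c w \<longleftrightarrow> (h u - h w) mod 3 = 0"
      using c grid_adj_in_grid[OF that(1)] grid_adj_in_grid[OF that(2)] by (simp add: of_int_mod3_eq_iff)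
    then show ?thesis using near[OF that(1)] near[OF that(2)] by auto
  qed
  then have "flippable m n c v \<longleftrightarrow> v \<in> grid m n \<and>
      (\<forall>u w. grid_adj m n v u \<longrightarrow> grid_adj m n v w \<longrightarrow> h u = h w)"
    unfolding flippable_def by blast
  also have "\<dots> \<longleftrightarrow> strict_local_max m n h v \<or> strict_local_min m n h v"
    unfolding strict_local_max_iff strict_local_min_iff using near by metis
  finally show ?thesis .
qed

lemma reduction_proper:
  assumes "unit_steps m n h"
  shows "(\<lambda>v \<in> grid m n. of_int (h v)) \<in> proper_colourings m n"
proof -
  have "(of_int (h u) :: 3) \<noteq> of_int (h v)" if "grid_adj m n u v" for u v
  proof -
    have "h u - h v = 1 \<or> h u - h v = - 1" using assms that unfolding unit_steps_def by smt
    then show ?thesis unfolding of_int_mod3_eq_iff by auto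
  qed
  then show ?thesis
    using grid_adj_in_grid[of m n] by (simp add: proper_colourings_def)
qed

section \<open>Height bounds and the case of unique extrema\<close>

lemma finite_grid: "finite (grid m n)"
  by (simp add: grid_def)

text \<open>Transfers the results on maxima to minima.\<close>

lemma strict_local_min_iff_max_uminus:
  "strict_local_min m n h v \<longleftrightarrow> strict_local_max m n (\<lambda>w. - h w) v"
proof -
  have "- h u = - h v - 1 \<longleftrightarrow> h u = h v + 1" for u by linarith
  then show ?thesis by (simp only: strict_local_min_iff strict_local_max_iff)
qed

lemma unit_steps_uminus: "unit_steps m n (\<lambda>w. - h w) \<longleftrightarrow> unit_steps m n h"
proof -
  have "\<bar>- h u - - h v\<bar> = \<bar>h u - h v\<bar>" for u v by linarith
  then show ?thesis by (simp only: unit_steps_def)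
qed

lemma maximal_on_finite:
  fixes h :: "'a \<Rightarrow> int"
  assumes "finite S" "S \<noteq> {}"
  obtains p where "p \<in> S" "\<And>v. v \<in> S \<Longrightarrow> h v \<le> h p"
proof -
  have "Max (h ` S) \<in> h ` S" using assms by simp
  then obtain p where "p \<in> S" "h p = Max (h ` S)" by auto
  then show ?thesis using that[of p] assms(1) by simp
qed

text \<open>A global maximum on the finite grid works: its neighbours are not higher, yet differ
  from it by exactly 1.\<close>

lemma strict_local_max_exists:
  assumes "m \<ge> 1" "n \<ge> 1" and h: "unit_steps m n h"
  shows "\<exists>p. strict_local_max m n h p"
proof -
  have "grid m n \<noteq> {}" using assms by (auto simp: grid_def)
  then obtain p where p: "p \<in> grid m n" "\<And>v. v \<in> grid m n \<Longrightarrow> h v \<le> h p"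
    using maximal_on_finite[OF finite_grid] by metis
  have "h u = h p - 1" if "grid_adj m n p u" for u
    using p(2)[of u] grid_adj_in_grid[OF that] h that unfolding unit_steps_def by smt
  then show ?thesis using p(1) strict_local_max_iff by blast
qed

definition grid_dist :: "nat \<times> nat \<Rightarrow> nat \<times> nat \<Rightarrow> int" where
  "grid_dist u v = \<bar>int (fst u) - int (fst v)\<bar> + \<bar>int (snd u) - int (snd v)\<bar>"

text \<open>A vertex violating the bound of maximal height is not the local maximum, so it has a
  higher neighbour, which violates the bound as well.\<close>

lemma height_le_unique_max:
  assumes h: "unit_steps m n h" and p: "{v. strict_local_max m n h v} = {p}" and v: "v \<in> grid m n"
  shows "h v + grid_dist v p \<le> h p"
proof (rule ccontr)
  assume "\<not> ?thesis"
  define S where "S = {w \<in> grid m n. h w + grid_dist w p > h p}"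
  have "v \<in> S" using v \<open>\<not> _\<close> by (simp add: S_def)
  then have "S \<noteq> {}" by blast
  moreover have "finite S" using finite_grid by (simp add: S_def)
  \<comment> \<open>Taking a highest violating vertex replaces the climb along a path: its higher
    neighbour will again lie in \<open>S\<close>, a contradiction.\<close>
  ultimately obtain w where w: "w \<in> S" "\<And>u. u \<in> S \<Longrightarrow> h u \<le> h w"
    using maximal_on_finite by metis
  then have "w \<noteq> p" "w \<in> grid m n" by (auto simp: S_def grid_dist_def)
  then obtain u where u: "grid_adj m n w u" "h u \<noteq> h w - 1"
    using p strict_local_max_iff by blast
  then have hu: "h u = h w + 1" using h unfolding unit_steps_def by smt
  have "grid_dist w p \<le> grid_dist u p + 1"
    using u(1) by (auto simp: grid_adj_def grid_dist_def)
  then have "u \<in> S" using w(1) hu grid_adj_in_grid[OF u(1)] by (auto simp: S_def)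
  then show False using w(2)[of u] hu by simp
qed

lemma int_lipschitz_interval:
  fixes f :: "nat \<Rightarrow> int"
  assumes step: "\<And>i. a \<le> i \<Longrightarrow> i < b \<Longrightarrow> \<bar>f (Suc i) - f i\<bar> \<le> 1"
    and "x \<in> {a..b}" "y \<in> {a..b}"
  shows "\<bar>f x - f y\<bar> \<le> \<bar>int x - int y\<bar>"
proof -
  have *: "\<bar>f y - f x\<bar> \<le> int y - int x" if "a \<le> x" "x \<le> y" "y \<le> b" for x y
    using that(2,3)
  proof (induction y rule: dec_induct)
    case base then show ?case by simp
  next
    case (step y)
    then show ?case using assms(1)[of y] that(1) by linarith
  qed
  show ?thesis using *[of x y] *[of y x] assms(2,3) by (cases "x \<le> y") auto
qed

text \<open>The L-shaped path through \<open>(i', j)\<close> has length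
  \<open>grid_dist u v\<close>, and each of its edges changes the height by 1.\<close>

lemma height_lipschitz:
  assumes h: "unit_steps m n h" and "u \<in> grid m n" "v \<in> grid m n"
  shows "h u - h v \<le> grid_dist u v"
proof -
  obtain i j i' j' where uv: "u = (i, j)" "v = (i', j')" by fastforce
  have g: "i \<in> {1..m}" "i' \<in> {1..m}" "j \<in> {1..n}" "j' \<in> {1..n}"
    using assms by (auto simp: uv grid_def)
  have "\<bar>h (i, j) - h (i', j)\<bar> \<le> \<bar>int i - int i'\<bar>"
  proof (rule int_lipschitz_interval[OF _ g(1,2), of "\<lambda>a. h (a, j)"])
    fix a assume "1 \<le> a" "a < m"
    then have "grid_adj m n (Suc a, j) (a, j)" using g by (auto simp: grid_adj_def grid_def)
    then show "\<bar>h (Suc a, j) - h (a, j)\<bar> \<le> 1" using h by (simp add: unit_steps_def)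
  qed
  moreover have "\<bar>h (i', j) - h (i', j')\<bar> \<le> \<bar>int j - int j'\<bar>"
  proof (rule int_lipschitz_interval[OF _ g(3,4), of "\<lambda>b. h (i', b)"])
    fix b assume "1 \<le> b" "b < n"
    then have "grid_adj m n (i', Suc b) (i', b)" using g by (auto simp: grid_adj_def grid_def)
    then show "\<bar>h (i', Suc b) - h (i', b)\<bar> \<le> 1" using h by (simp add: unit_steps_def)
  qed
  ultimately show ?thesis by (simp add: uv grid_dist_def)
qed

text \<open>Every vertex lies on a geodesic between the two extrema; the vertices of the boundary
  lines through them then force the extrema into opposite corners.\<close>

lemma gradient_of_unique_extrema:
  assumes h: "unit_steps m n h"
    and p: "{v. strict_local_max m n h v} = {p}" and q: "{v. strict_local_min m n h v} = {q}"
  shows "\<exists>e1 \<in> {1, -1}. \<exists>e2 \<in> {1, -1}. \<forall>v \<in> grid m n. h v = h (1, 1) + corner_gradient m n e1 e2 v"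
proof -
  have pg: "p \<in> grid m n" and qg: "q \<in> grid m n"
    using p q by (auto simp: strict_local_max_iff strict_local_min_iff)
  have upper: "h v + grid_dist v p \<le> h p" if "v \<in> grid m n" for v
    using height_le_unique_max[OF h p that] .
  \<comment> \<open>This is the bound for maxima applied to the negated heights, whose only strict
    local maximum is \<open>q\<close>.\<close>
  have lower: "h q + grid_dist v q \<le> h v" if "v \<in> grid m n" for v
    using height_le_unique_max[of m n "\<lambda>w. - h w" q v] h q that
    by (simp add: unit_steps_uminus flip: strict_local_min_iff_max_uminus)
  have pq: "h p - h q \<le> grid_dist p q" by (rule height_lipschitz[OF h pg qg])
  have tri: "grid_dist p q \<le> grid_dist v p + grid_dist v q" for v
    by (simp add: grid_dist_def)
  \<comment> \<open>Adding \<open>upper\<close> and \<open>lower\<close> bounds the sum of the two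
    distances by \<open>h p - h q\<close>, hence by \<open>grid_dist p q\<close>. The triangle
    inequality then turns every inequality into an equality.\<close>
  have geod: "grid_dist v p + grid_dist v q = grid_dist p q" and val: "h v = h p - grid_dist v p"
    if "v \<in> grid m n" for v
    using upper[OF that] lower[OF that] pq tri[of v] by linarith+
  obtain p1 p2 q1 q2 where pq': "p = (p1, p2)" "q = (q1, q2)" by fastforce
  have g: "1 \<le> p1" "p1 \<le> m" "1 \<le> q1" "q1 \<le> m" "1 \<le> p2" "p2 \<le> n" "1 \<le> q2" "q2 \<le> n"
    using pg qg by (auto simp: pq' grid_def)
  have "(1, p2) \<in> grid m n" "(m, p2) \<in> grid m n" "(p1, 1) \<in> grid m n" "(p1, n) \<in> grid m n"
    "(1, 1) \<in> grid m n"
    using g by (auto simp: grid_def)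
  note corners = this
  \<comment> \<open>The geodesic equation at \<open>(1, p2)\<close> says that the smaller of
    \<open>p1\<close> and \<open>q1\<close> is 1; at \<open>(m, p2)\<close> it says that the larger
    is \<open>m\<close>.\<close>
  have p1: "p1 = 1 \<or> p1 = m"
    using geod[OF corners(1)] geod[OF corners(2)] g by (simp add: pq' grid_dist_def) linarith
  have p2: "p2 = 1 \<or> p2 = n"
    using geod[OF corners(3)] geod[OF corners(4)] g by (simp add: pq' grid_dist_def) linarith
  \<comment> \<open>The signs point uphill, towards \<open>p\<close>.\<close>
  define e1 e2 :: int where "e1 = (if p1 = 1 then -1 else 1)" and "e2 = (if p2 = 1 then -1 else 1)"
  have "h v = h (1, 1) + corner_gradient m n e1 e2 v" if v: "v \<in> grid m n" for v
  proof -
    obtain i j where ij: "v = (i, j)" "1 \<le> i" "i \<le> m" "1 \<le> j" "j \<le> n"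
      using v by (cases v) (auto simp: grid_def)
    have "\<bar>int i - int p1\<bar> = \<bar>1 - int p1\<bar> - e1 * (int i - 1)"
      using p1 ij by (auto simp: e1_def)
    moreover have "\<bar>int j - int p2\<bar> = \<bar>1 - int p2\<bar> - e2 * (int j - 1)"
      using p2 ij by (auto simp: e2_def)
    ultimately show ?thesis
      using val[OF v] val[OF corners(5)] v by (simp add: corner_gradient_def grid_dist_def ij pq')
  qed
  moreover have "e1 \<in> {1, -1}" "e2 \<in> {1, -1}" by (auto simp: e1_def e2_def)
  ultimately show ?thesis by blast
qed

section \<open>Corner gradients and their extrema\<close>

lemma corner_gradient_normalised:
  assumes "m \<ge> 1" "n \<ge> 1" "e1 \<in> {1, -1}" "e2 \<in> {1, -1}"
  shows "corner_gradient m n e1 e2 \<in> normalised_heights m n"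
  using assms
  by (auto simp: normalised_heights_def height_functions_def corner_gradient_def grid_adj_def
      grid_def algebra_simps)

lemma unit_steps_corner_gradient:
  assumes "e1 \<in> {1, -1}" "e2 \<in> {1, -1}"
  shows "unit_steps m n (corner_gradient m n e1 e2)"
  using assms
  by (auto simp: unit_steps_def corner_gradient_def grid_adj_def algebra_simps)

text \<open>Away from the lowest corner, some coordinate can still move against its sign within the
  grid, which lowers the height.\<close>

lemma corner_gradient_min:
  assumes "m \<ge> 1" "n \<ge> 1" and e: "e1 \<in> {1, -1}" "e2 \<in> {1, -1}"
  shows "{v. strict_local_min m n (corner_gradient m n e1 e2) v} =
    {(if e1 = 1 then 1 else m, if e2 = 1 then 1 else n)}"
proof -
  let ?h = "corner_gradient m n e1 e2"
  have "strict_local_min m n ?h (i, j) \<longleftrightarrow>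
    i = (if e1 = 1 then 1 else m) \<and> j = (if e2 = 1 then 1 else n)" (is "?L \<longleftrightarrow> ?R") for i j
  proof
    assume L: ?L
    then have g: "(i, j) \<in> grid m n" and up: "\<And>u. grid_adj m n (i, j) u \<Longrightarrow> ?h u = ?h (i, j) + 1"
      using strict_local_min_iff by blast+
    have "i = (if e1 = 1 then 1 else m)"
    proof (rule ccontr)
      assume ne: "i \<noteq> (if e1 = 1 then 1 else m)"
      let ?i = "if e1 = 1 then i - 1 else Suc i"
      have a: "grid_adj m n (i, j) (?i, j)" using ne g by (auto simp: grid_adj_def grid_def)
      then show False
        using up[OF a] grid_adj_in_grid[OF a] e
        by (auto simp: corner_gradient_def grid_def algebra_simps split: if_splits)
    qed
    moreover have "j = (if e2 = 1 then 1 else n)"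
    proof (rule ccontr)
      assume ne: "j \<noteq> (if e2 = 1 then 1 else n)"
      let ?j = "if e2 = 1 then j - 1 else Suc j"
      have a: "grid_adj m n (i, j) (i, ?j)" using ne g by (auto simp: grid_adj_def grid_def)
      then show False
        using up[OF a] grid_adj_in_grid[OF a] e
        by (auto simp: corner_gradient_def grid_def algebra_simps split: if_splits)
    qed
    ultimately show ?R by blast
  next
    assume ?R
    then show ?L using assms
      by (auto simp: strict_local_min_iff corner_gradient_def grid_adj_def grid_def
          algebra_simps split: if_splits)
  qed
  then show ?thesis by auto
qed

lemma corner_gradient_max:
  assumes "m \<ge> 1" "n \<ge> 1" and e: "e1 \<in> {1, -1}" "e2 \<in> {1, -1}"
  shows "{v. strict_local_max m n (corner_gradient m n e1 e2) v} =
    {(if e1 = 1 then m else 1, if e2 = 1 then n else 1)}"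
proof -
  \<comment> \<open>The identity is restricted to the grid because both gradients are
    \<open>undefined\<close> outside it; extrema only involve grid vertices.\<close>
  have neg: "corner_gradient m n (- e1) (- e2) v = - corner_gradient m n e1 e2 v"
    if "v \<in> grid m n" for v
    using that by (auto simp: corner_gradient_def split: prod.splits)
  have "strict_local_max m n (corner_gradient m n e1 e2) v \<longleftrightarrow>
      strict_local_min m n (corner_gradient m n (- e1) (- e2)) v" for v
    unfolding strict_local_max_iff strict_local_min_iff
    using neg grid_adj_in_grid by (smt (verit))
  then have "{v. strict_local_max m n (corner_gradient m n e1 e2) v} =
      {v. strict_local_min m n (corner_gradient m n (- e1) (- e2)) v}" by blast
  also have "\<dots> = {(if - e1 = 1 then 1 else m, if - e2 = 1 then 1 else n)}"
    using assms by (intro corner_gradient_min) auto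
  finally show ?thesis using e by auto
qed

section \<open>Classification and count of the vertices of degree 2\<close>

lemma card_two_disjoint_nonempty:
  assumes "card (A \<union> B) = 2" "A \<inter> B = {}" "A \<noteq> {}" "B \<noteq> {}"
  obtains p q where "A = {p}" "B = {q}"
proof -
  have "finite (A \<union> B)" using assms(1) by (metis card.infinite zero_neq_numeral)
  then have "card A + card B = 2" "card A > 0" "card B > 0"
    using assms by (auto simp: card_Un_disjoint card_gt_0_iff)
  then have "card A = 1" "card B = 1" by linarith+
  then show ?thesis using that by (metis card_1_singletonE)
qed

text \<open>Degree 2 leaves the lift of \<open>c\<close> with one maximum and one minimum, so it is
  a gradient up to an additive constant, which a colour rotation absorbs.\<close>

lemma degree_two_imp_corner_gradient:
  assumes mn: "m \<ge> 2" "n \<ge> 2" and c: "c \<in> proper_colourings m n"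
    and deg: "ofg_degree m n (colouring_orbit m n c) = 2"
  shows "\<exists>e1 \<in> {1, -1}. \<exists>e2 \<in> {1, -1}.
    colouring_orbit m n c = vertex_of_height m n (corner_gradient m n e1 e2)"
proof -
  define h where "h = colouring_lift c"
  have h: "unit_steps m n h" unfolding h_def by (rule unit_steps_colouring_lift[OF c])
  have ch: "c w = of_int (h w) + c (1, 1)" if "w \<in> grid m n" for w
    unfolding h_def by (rule of_int_colouring_lift[OF c that])
  let ?Max = "{v. strict_local_max m n h v}" and ?Min = "{v. strict_local_min m n h v}"
  have "{v. flippable m n c v} = ?Max \<union> ?Min"
    using flippable_iff_local_extremum[OF h ch] by auto
  then have "card (?Max \<union> ?Min) = 2"
    using deg ofg_degree_eq_card_flippable[OF mn c] by simp
  \<comment> \<open>An isolated vertex would satisfy both conditions vacuously; here every vertex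
    has a neighbour.\<close>
  moreover have "?Max \<inter> ?Min = {}"
  proof -
    have False if v: "strict_local_max m n h v" "strict_local_min m n h v" for v
    proof -
      obtain u where "grid_adj m n v u"
        using v(1) grid_neighbour_exists[OF mn] unfolding strict_local_max_iff by blast
      then have "h u = h v - 1" "h u = h v + 1"
        using v unfolding strict_local_max_iff strict_local_min_iff by blast+
      then show False by simp
    qed
    then show ?thesis by blast
  qed
  moreover have "?Max \<noteq> {}" "?Min \<noteq> {}"
    using strict_local_max_exists[of m n h] strict_local_max_exists[of m n "\<lambda>w. - h w"] h mn
    by (auto simp: unit_steps_uminus strict_local_min_iff_max_uminus)
  ultimately obtain p q where "?Max = {p}" "?Min = {q}"
    using card_two_disjoint_nonempty by metis
  then obtain e1 e2 where e: "e1 \<in> {1, -1}" "e2 \<in> {1, -1}"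
    and grad: "\<And>v. v \<in> grid m n \<Longrightarrow> h v = h (1, 1) + corner_gradient m n e1 e2 v"
    using gradient_of_unique_extrema[OF h] by meson
  let ?r = "\<lambda>v \<in> grid m n. of_int (corner_gradient m n e1 e2 v) :: 3"
  \<comment> \<open>The rotation amount collects the two constants: the offset of the lift from the
    gradient and the base colour from \<open>ch\<close>.\<close>
  have "c v = rotate_colouring m n (of_int (h (1, 1)) + c (1, 1)) ?r v" for v
  proof (cases "v \<in> grid m n")
    case True
    then show ?thesis using ch[OF True] grad[OF True] by (simp add: rotate_colouring_def)
  next
    case False
    then show ?thesis
      using extensional_arb[OF proper_extensional[OF c]] by (simp add: rotate_colouring_def)
  qed
  then have "c = rotate_colouring m n (of_int (h (1, 1)) + c (1, 1)) ?r" by (rule ext)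
  then have "c \<in> colouring_orbit m n ?r" unfolding colouring_orbit_def by (rule range_eqI)
  then have "colouring_orbit m n c = vertex_of_height m n (corner_gradient m n e1 e2)"
    unfolding vertex_of_height_def by (rule orbit_eq_of_mem)
  then show ?thesis using e by blast
qed

lemma vertex_of_height_in_ofg:
  "unit_steps m n h \<Longrightarrow> vertex_of_height m n h \<in> ofg_verts m n"
  using reduction_proper by (simp add: vertex_of_height_def ofg_verts_def)

lemma ofg_degree_corner_gradient:
  assumes mn: "m \<ge> 2" "n \<ge> 2" and e: "e1 \<in> {1, -1}" "e2 \<in> {1, -1}"
  shows "ofg_degree m n (vertex_of_height m n (corner_gradient m n e1 e2)) = 2"
proof -
  let ?h = "corner_gradient m n e1 e2"
  let ?r = "\<lambda>v \<in> grid m n. of_int (?h v) :: 3"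
  have h: "unit_steps m n ?h" using e by (rule unit_steps_corner_gradient)
  have "{v. flippable m n ?r v} = {v. strict_local_max m n ?h v} \<union> {v. strict_local_min m n ?h v}"
    using flippable_iff_local_extremum[OF h, of ?r 0] by auto
  also have "\<dots> = {(if e1 = 1 then m else 1, if e2 = 1 then n else 1),
      (if e1 = 1 then 1 else m, if e2 = 1 then 1 else n)}"
    using corner_gradient_max[of m n e1 e2] corner_gradient_min[of m n e1 e2] mn e by auto
  \<comment> \<open>The two corners are distinct because their first coordinates are 1 and
    \<open>m\<close> in some order, with \<open>m \<ge> 2\<close>.\<close>
  finally have "card {v. flippable m n ?r v} = 2" using mn by (auto simp: card_insert_if)
  then show ?thesis
    unfolding vertex_of_height_def
    using ofg_degree_eq_card_flippable[OF mn reduction_proper[OF h]] by simp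
qed

text \<open>All gradients vanish at (1, 1), so equal orbits give equal colourings. The colours at
  (2, 1) and (1, 2) then reveal the signs, as 1 and -1 are distinct modulo 3.\<close>

lemma vertex_of_corner_gradient_inj:
  assumes mn: "m \<ge> 2" "n \<ge> 2"
    and e: "e1 \<in> {1, -1}" "e2 \<in> {1, -1}" "f1 \<in> {1, -1}" "f2 \<in> {1, -1}"
    and eq: "vertex_of_height m n (corner_gradient m n e1 e2) =
      vertex_of_height m n (corner_gradient m n f1 f2)"
  shows "e1 = f1 \<and> e2 = f2"
proof -
  let ?r = "\<lambda>e1 e2. \<lambda>v \<in> grid m n. of_int (corner_gradient m n e1 e2 v) :: 3"
  have g: "(1, 1) \<in> grid m n" "(2, 1) \<in> grid m n" "(1, 2) \<in> grid m n"
    using mn by (auto simp: grid_def)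
  have "?r e1 e2 = ?r f1 f2"
    using orbit_eq_agree[OF _ _ eq[unfolded vertex_of_height_def] g(1)] g(1)
    by (simp add: corner_gradient_def)
  then have "?r e1 e2 (2, 1) = ?r f1 f2 (2, 1)" "?r e1 e2 (1, 2) = ?r f1 f2 (1, 2)"
    by (rule fun_cong)+
  then have "(of_int e1 :: 3) = of_int f1" "(of_int e2 :: 3) = of_int f2"
    using g by (auto simp: corner_gradient_def)
  then show ?thesis using e by (auto simp: of_int_mod3_eq_iff)
qed

theorem theorem3p2:
  fixes m n :: nat
  assumes "m \<ge> 2" and "n \<ge> 2"
  shows "card {v \<in> ofg_verts m n. ofg_degree m n v = 2} = 4 \<and>
    {v \<in> ofg_verts m n. ofg_degree m n v = 2} =
      {vertex_of_height m n (corner_gradient m n e1 e2) | e1 e2. e1 \<in> {1, -1} \<and> e2 \<in> {1, -1}} \<and>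
    (\<forall>e1 \<in> {1, -1}. \<forall>e2 \<in> {1, -1}.
      corner_gradient m n e1 e2 \<in> normalised_heights m n \<and>
      (\<exists>p q. {v. strict_local_min m n (corner_gradient m n e1 e2) v} = {p} \<and>
             {v. strict_local_max m n (corner_gradient m n e1 e2) v} = {q} \<and>
             opposite_corners m n p q))"
proof (intro conjI ballI)
  let ?f = "\<lambda>(e1, e2). vertex_of_height m n (corner_gradient m n e1 e2)"
  let ?E = "{1, -1} \<times> {1, -1} :: (int \<times> int) set"
  let ?G = "{vertex_of_height m n (corner_gradient m n e1 e2) | e1 e2. e1 \<in> {1, -1} \<and> e2 \<in> {1, -1}}"
  show deg2: "{v \<in> ofg_verts m n. ofg_degree m n v = 2} = ?G"
  proof (intro equalityI subsetI)
    fix A assume "A \<in> {v \<in> ofg_verts m n. ofg_degree m n v = 2}"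
    then obtain c where "c \<in> proper_colourings m n" "A = colouring_orbit m n c"
      "ofg_degree m n (colouring_orbit m n c) = 2"
      by (auto simp: ofg_verts_def)
    then show "A \<in> ?G" using degree_two_imp_corner_gradient[OF assms] by blast
  next
    fix A assume "A \<in> ?G"
    then show "A \<in> {v \<in> ofg_verts m n. ofg_degree m n v = 2}"
      using ofg_degree_corner_gradient[OF assms] vertex_of_height_in_ofg[OF unit_steps_corner_gradient]
      by blast
  qed
  \<comment> \<open>The count is that of the four sign pairs, transported along the injective map
    \<open>?f\<close>.\<close>
  have "?G = ?f ` ?E" by (auto simp only: mem_Sigma_iff image_iff)
  moreover have "inj_on ?f ?E"
  proof (rule inj_onI)
    fix x y assume "x \<in> ?E" "y \<in> ?E" "?f x = ?f y"
    then show "x = y"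
      using vertex_of_corner_gradient_inj[OF assms, of "fst x" "snd x" "fst y" "snd y"]
      by (simp only: mem_Times_iff prod_eq_iff split_beta)
  qed
  ultimately have "card ?G = card ?E" by (simp only: card_image)
  then show "card {v \<in> ofg_verts m n. ofg_degree m n v = 2} = 4"
    unfolding deg2 by (simp add: card_cartesian_product)
next
  fix e1 e2 :: int assume e: "e1 \<in> {1, -1}" "e2 \<in> {1, -1}"
  have mn: "m \<ge> 1" "n \<ge> 1" using assms by auto
  show "corner_gradient m n e1 e2 \<in> normalised_heights m n"
    by (rule corner_gradient_normalised[OF mn e])
  \<comment> \<open>Equal signs give the corners (1, 1) and \<open>(m, n)\<close>, unequal signs the
    corners \<open>(1, n)\<close> and \<open>(m, 1)\<close>.\<close>
  have "opposite_corners m n (if e1 = 1 then 1 else m, if e2 = 1 then 1 else n)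
      (if e1 = 1 then m else 1, if e2 = 1 then n else 1)"
    by (auto simp: opposite_corners_def)
  then show "\<exists>p q. {v. strict_local_min m n (corner_gradient m n e1 e2) v} = {p} \<and>
      {v. strict_local_max m n (corner_gradient m n e1 e2) v} = {q} \<and> opposite_corners m n p q"
    using corner_gradient_min[OF mn e] corner_gradient_max[OF mn e] by blast
qed

end
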